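(* Let $G$ be a finite cyclic group of order $n$. The proper power graph $P^\ast(G)$ is non-planar if and only if $n \geq 7$.
   Context: The power graph $P(G)$ of a group $G$ is the simple undirected graph with vertex set $G$ in which two distinct vertices $a,b$ are adjacent if and only if $a\in\langle b\rangle$ or $b\in\langle a\rangle$. The proper power graph $P^\ast(G)$ is the graph obtained from $P(G)$ by deleting the vertex corresponding to the identity element. A graph is planar if it can be drawn in the plane with no edges crossing; equivalently (Kuratowski), if it contains no subgraph that is a subdivision of $K_5$ or $K_{3,3}$. *)

theory Defs
  imports
    "HOL-Algebra.Elementary_Groups"
    "HOL-Analysis.Analysis"
    "Graph_Theory.Pair_Digraph"
begin

text \<open>Undirected simple graphs are represented, as in \<open>Graph_Theory\<close>, by symmetric loop-free
  digraphs: an undirected edge is a pair of opposite arcs.\<close>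

definition power_graph :: "('g, 'm) monoid_scheme \<Rightarrow> ('g, 'g \<times> 'g) pre_digraph" where
  "power_graph G = with_proj
     \<lparr> pverts = carrier G,
       parcs = {(a, b). a \<in> carrier G \<and> b \<in> carrier G \<and> a \<noteq> b \<and>
                        (a \<in> generate G {b} \<or> b \<in> generate G {a})} \<rparr>"

definition proper_power_graph :: "('g, 'm) monoid_scheme \<Rightarrow> ('g, 'g \<times> 'g) pre_digraph" where
  "proper_power_graph G = pre_digraph.del_vert (power_graph G) \<one>\<^bsub>G\<^esub>"

definition undirected_edges :: "('v, 'e) pre_digraph \<Rightarrow> 'v set set" where
  "undirected_edges H = {{u, v} | u v. (u, v) \<in> arcs_ends H}"

text \<open>A drawing of \<open>H\<close> in the plane (here \<^typ>\<open>complex\<close>) without crossings: \<open>p\<close> places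
  the vertices, and \<open>\<gamma>\<close> draws each undirected edge as a simple arc joining its ends. An
  arc meets no vertex other than its ends, and two distinct arcs meet only in common ends. Being
  stated with \<^const>\<open>arc\<close>, which excludes closed curves, this is meant for loop-free graphs.\<close>

definition plane_drawing ::
    "('v, 'e) pre_digraph \<Rightarrow> ('v \<Rightarrow> complex) \<Rightarrow> ('v set \<Rightarrow> real \<Rightarrow> complex) \<Rightarrow> bool" where
  "plane_drawing H p \<gamma> \<longleftrightarrow>
     inj_on p (verts H) \<and>
     (\<forall>e \<in> undirected_edges H.
        arc (\<gamma> e) \<and>
        {pathstart (\<gamma> e), pathfinish (\<gamma> e)} = p ` e \<and>
        path_image (\<gamma> e) \<inter> p ` verts H = p ` e) \<and>
     (\<forall>e \<in> undirected_edges H. \<forall>f \<in> undirected_edges H. e \<noteq> f \<longrightarrow>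
        path_image (\<gamma> e) \<inter> path_image (\<gamma> f) \<subseteq> p ` (e \<inter> f))"

definition planar :: "('v, 'e) pre_digraph \<Rightarrow> bool" where
  "planar H \<longleftrightarrow> (\<exists>p \<gamma>. plane_drawing H p \<gamma>)"

end

theory Submission
  imports Defs "HOL-Algebra.Multiplicative_Group"
begin

text \<open>
  For \<open>n \<ge> 7\<close> there are four residues coprime to \<open>n\<close>; the corresponding generators are
  adjacent to everything, so together with any fifth vertex they span a complete graph on five
  vertices. That this graph has no plane drawing follows from the Jordan curve theorem and
  Janiszewski's theorem: let \<open>a, b, c, d, e\<close> be its vertices and let \<open>V\<close> be the side of the
  triangle \<open>abc\<close> that does not contain \<open>e\<close>. A point \<open>y\<close> of \<open>V\<close> can be joined to \<open>e\<close> off each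
  of the triangles \<open>abd\<close>, \<open>acd\<close>, \<open>bcd\<close>: go inside \<open>V\<close> to the omitted vertex, then along its edge
  to \<open>e\<close>. Since \<open>bcd\<close> and \<open>acd\<close> meet in an arc, and so does their union with \<open>abd\<close>,
  Janiszewski's theorem joins \<open>y\<close> to \<open>e\<close> off all three triangles, hence off \<open>abc\<close>, which is
  absurd. For \<open>n \<le> 6\<close> the graph embeds into a straight-line drawing of the complete graph on
  five vertices minus two edges.
\<close>

section \<open>Nonplanarity of the complete graph on five vertices\<close>

text \<open>By injectivity this is the image of the interval from 0 to 1 without 0, which is
  connected. It serves edges that touch a triangle only at one end.\<close>

lemma connected_arc_minus_start:
  fixes g :: "real \<Rightarrow> 'a::t2_space"
  assumes "arc g"
  shows "connected (path_image g - {pathstart g})"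
proof -
  have "path_image g - {pathstart g} = g ` {0<..1}"
  proof -
    have "{0..1::real} = insert 0 {0<..1}" by auto
    moreover have "inj_on g {0..1}" using assms by (simp add: arc_def)
    ultimately show ?thesis
      unfolding path_image_def pathstart_def by (auto simp: inj_on_def)
  qed
  moreover have "connected (g ` {0<..1})"
    using assms unfolding arc_def path_def
    by (intro connected_continuous_image) (auto elim: continuous_on_subset)
  ultimately show ?thesis by simp
qed

lemma connected_subset_of_separation:
  fixes X :: "'a::topological_space set"
  assumes "connected X" "open U" "open V" "U \<inter> V = {}" "X \<subseteq> U \<union> V" "x \<in> X" "x \<in> U"
  shows "X \<subseteq> U"
  using connectedD[OF assms(1-3)] assms(4-) by blast

text \<open>Edges enter only as a symmetric family of point sets; a direction is chosen afresh
  wherever an arc is needed, so the roles of the vertices can be permuted freely.\<close>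

lemma complete_graph_5_not_plane:
  fixes p :: "'v \<Rightarrow> complex" and E :: "'v \<Rightarrow> 'v \<Rightarrow> complex set"
  assumes dist: "distinct [a, b, c, d, e]" and W: "W = {a, b, c, d, e}"
    and arc: "\<And>x y. x \<in> W \<Longrightarrow> y \<in> W \<Longrightarrow> x \<noteq> y \<Longrightarrow>
      \<exists>g. arc g \<and> pathstart g = p x \<and> pathfinish g = p y \<and> path_image g = E x y"
    and sym: "\<And>x y. E x y = E y x"
    and vert: "\<And>x y z. x \<in> W \<Longrightarrow> y \<in> W \<Longrightarrow> z \<in> W \<Longrightarrow> x \<noteq> y \<Longrightarrow> z \<noteq> x \<Longrightarrow> z \<noteq> y \<Longrightarrow> p z \<notin> E x y"
    and adj: "\<And>x y z. x \<in> W \<Longrightarrow> y \<in> W \<Longrightarrow> z \<in> W \<Longrightarrow> x \<noteq> y \<Longrightarrow> x \<noteq> z \<Longrightarrow> y \<noteq> z \<Longrightarrow>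
      E x y \<inter> E x z \<subseteq> {p x}"
    and disj: "\<And>x y z w. distinct [x, y, z, w] \<Longrightarrow> {x, y, z, w} \<subseteq> W \<Longrightarrow> E x y \<inter> E z w = {}"
  shows False
proof -
  have ends: "p x \<in> E x y" "p y \<in> E x y" and conn: "connected (E x y)" and comp: "compact (E x y)"
    and half: "connected (E x y - {p x})"
    if "x \<in> W" "y \<in> W" "x \<noteq> y" for x y
    using arc[OF that] connected_arc_minus_start
    by (metis pathstart_in_path_image pathfinish_in_path_image connected_arc_image compact_arc_image)+
  define T where "T x y z = E x y \<union> E x z \<union> E y z" for x y z
  obtain g where g: "simple_path g" "pathfinish g = pathstart g" "path_image g = T a b c"
  proof -
    obtain g1 g2 g3 where
      "arc g1 \<and> pathstart g1 = p a \<and> pathfinish g1 = p b \<and> path_image g1 = E a b"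
      "arc g2 \<and> pathstart g2 = p b \<and> pathfinish g2 = p c \<and> path_image g2 = E b c"
      "arc g3 \<and> pathstart g3 = p c \<and> pathfinish g3 = p a \<and> path_image g3 = E c a"
      using arc[of a b] arc[of b c] arc[of c a] dist W by auto
    note g = this
    have "path_image g1 \<inter> path_image g2 \<subseteq> {p b}" "path_image g2 \<inter> path_image g3 \<subseteq> {p c}"
      "path_image g1 \<inter> path_image g3 \<subseteq> {p a}"
      using g adj[of b a c] adj[of c a b] adj[of a b c] sym dist W by auto
    then have "simple_path (g1 +++ g2 +++ g3)"
      using g by (intro simple_path_join3I) auto
    moreover have "path_image (g1 +++ g2 +++ g3) = T a b c"
      using g sym[of a c] by (auto simp: path_image_join T_def)
    ultimately show ?thesis using that[of "g1 +++ g2 +++ g3"] g by simp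
  qed
  have eT: "p e \<notin> T a b c" using vert dist W by (auto simp: T_def)
  \<comment> \<open>Either Jordan domain may contain \<open>p e\<close>, so boundedness is
    forgotten: \<open>U\<close> is the side of \<open>p e\<close> and \<open>V\<close> the other
    side.\<close>
  obtain U V where U: "open U" "p e \<in> U" and V: "V \<noteq> {}" "open V" "connected V" "U \<inter> V = {}"
    and UV: "U \<union> V = - T a b c" and frV: "frontier V = T a b c"
    using Jordan_curve[OF g(1,2)] eT unfolding g(3)
    by (metis ComplI Int_commute Un_commute Un_iff)
  have UT: "z \<notin> T a b c" if "z \<in> U" for z using UV that by auto
  have pT: "p x \<in> T a b c" if "x \<in> {a, b, c}" for x
    using that ends[of a b] ends[of a c] dist W unfolding T_def by auto
  obtain y where y: "y \<in> V" using V by blast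
  \<comment> \<open>The edge \<open>de\<close> misses the triangle, so \<open>d\<close> lies on the
    same side as \<open>e\<close>.\<close>
  have "E d e \<subseteq> U"
  proof (rule connected_subset_of_separation[where V = V and x = "p e"])
    have "E d e \<inter> T a b c = {}"
      unfolding T_def using disj[of d e a b] disj[of d e a c] disj[of d e b c] dist W by auto
    then show "E d e \<subseteq> U \<union> V" using UV by blast
  qed (use conn ends dist W U V in auto)
  then have dU: "p d \<in> U" using ends[of d e] dist W by auto
  \<comment> \<open>Such an edge meets the triangle only in \<open>p x\<close>; the rest is
    connected and contains \<open>p d\<close>, so it stays in \<open>U\<close>.\<close>
  have EU: "E x d \<inter> V = {}" if "x \<in> {a, b, c}" for x
  proof -
    have "E x d - {p x} \<subseteq> U"
    proof (rule connected_subset_of_separation[where V = V and x = "p d"])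
      have "(E x d - {p x}) \<inter> T a b c = {}"
        unfolding T_def using that dist W disj[of x d a b] disj[of x d a c] disj[of x d b c]
          adj[of x d a] adj[of x d b] adj[of x d c] sym by auto
      then show "E x d - {p x} \<subseteq> U \<union> V" using UV by blast
      have "p d \<noteq> p x" using UT[OF dU] pT[OF that] by metis
      moreover have "p d \<in> E x d" using ends(2)[of x d] that dist W by auto
      ultimately show "p d \<in> E x d - {p x}" by blast
    qed (use half[of x d] that dist W U V dU in auto)
    moreover have "p x \<notin> V" using pT[OF that] UV by auto
    ultimately show ?thesis using V(4) by blast
  qed
  have main: "connected_component (- T i j d) y (p e)"
    if ijk: "i \<in> {a, b, c}" "j \<in> {a, b, c}" "k \<in> {a, b, c}" "i \<noteq> j" "i \<noteq> k" "j \<noteq> k" for i j k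
  proof -
    have kT: "p k \<notin> T i j d" using vert ijk dist W unfolding T_def by auto
    have "E i j \<inter> V = {}" using UV ijk sym unfolding T_def by auto
    then have "T i j d \<inter> V = {}" using EU[of i] EU[of j] ijk unfolding T_def by auto
    \<comment> \<open>The whole triangle is the frontier of \<open>V\<close>, so \<open>V\<close>
      stays connected when the omitted vertex \<open>p k\<close> is added.\<close>
    moreover have "p k \<in> closure V"
      using frV pT[OF ijk(3)] unfolding frontier_def by auto
    then have "connected (insert (p k) V)"
      by (meson connected_intermediate_closure V(3) closure_subset insert_subsetI subset_insertI)
    ultimately have "connected_component (- T i j d) y (p k)"
      unfolding connected_component_def using y kT by blast
    moreover have "E k e \<inter> T i j d = {}"
      using ijk dist W disj[of k e i j] disj[of k e i d] disj[of k e j d] unfolding T_def by auto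
    then have "connected_component (- T i j d) (p k) (p e)"
      unfolding connected_component_def using conn[of k e] ends[of k e] ijk dist W by (intro exI[of _ "E k e"]) auto
    ultimately show ?thesis by (rule connected_component_trans)
  qed
  have compT: "compact (T x y z)" if "{x, y, z} \<subseteq> W" "distinct [x, y, z]" for x y z
    unfolding T_def using comp that by (intro compact_Un) auto
  \<comment> \<open>Janiszewski's theorem needs a connected intersection; here it is a single
    edge.\<close>
  have "T b c d \<inter> T a c d = E c d"
    unfolding T_def using dist W ends[of c d] adj[of c b a] adj[of d b a] adj[of c b d] adj[of d b c]
      adj[of c d a] adj[of d c a] disj[of b c a d] disj[of b d a c] sym by auto
  then have 1: "connected_component (- (T b c d \<union> T a c d)) y (p e)"
    using main[of b c a] main[of a c b] conn[of c d] dist W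
    using compT[of b c d] compT[of a c d]
    by (intro Janiszewski[OF _ compact_imp_closed]) auto
  \<comment> \<open>The third triangle meets the union in two edges that share \<open>p d\<close>,
    again a connected set.\<close>
  have "(T b c d \<union> T a c d) \<inter> T a b d = E a d \<union> E b d"
    unfolding T_def using dist W ends[of a d] ends[of b d]
      adj[of a b c] adj[of b a c] disj[of a b c d] adj[of b c d] adj[of a c d]
      disj[of b c a d] disj[of a c b d] adj[of a b d] adj[of b a d] adj[of d c b] adj[of d c a] sym by auto
  moreover have "connected (E a d \<union> E b d)"
    using conn[of a d] conn[of b d] ends[of a d] ends[of b d] dist W by (intro connected_Un) auto
  ultimately have "connected_component (- ((T b c d \<union> T a c d) \<union> T a b d)) y (p e)"
    using 1 main[of a b c] compT[of b c d] compT[of a c d] compT[of a b d] dist W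
    by (intro Janiszewski[OF compact_Un compact_imp_closed]) auto
  \<comment> \<open>Each side of \<open>abc\<close> lies on one of the three triangles, so
    \<open>y\<close> and \<open>p e\<close> are joined off \<open>abc\<close> although they lie on
    different sides.\<close>
  moreover have "T a b c \<subseteq> (T b c d \<union> T a c d) \<union> T a b d" unfolding T_def by auto
  ultimately obtain X where X: "connected X" "X \<inter> T a b c = {}" "y \<in> X" "p e \<in> X"
    unfolding connected_component_def by blast
  then have "X \<subseteq> U"
    using connected_subset_of_separation[of X U V "p e"] U V UV by blast
  then show False using X y V by blast
qed

lemma not_planar_if_complete_5:
  fixes H :: "('v, 'e) pre_digraph"
  assumes "W \<subseteq> verts H" "card W = 5"
    and adj: "\<And>u v. u \<in> W \<Longrightarrow> v \<in> W \<Longrightarrow> u \<noteq> v \<Longrightarrow> (u, v) \<in> arcs_ends H"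
  shows "\<not> planar H"
proof
  assume "planar H"
  then obtain p \<gamma> where D: "plane_drawing H p \<gamma>" unfolding planar_def by blast
  have inj: "inj_on p W" using D assms(1) unfolding plane_drawing_def by (blast intro: inj_on_subset)
  have edge: "{u, v} \<in> undirected_edges H" if "u \<in> W" "v \<in> W" "u \<noteq> v" for u v
    using adj[OF that] unfolding undirected_edges_def by blast
  define E where "E u v = path_image (\<gamma> {u, v})" for u v
  have e: "arc (\<gamma> {u, v})" "{pathstart (\<gamma> {u, v}), pathfinish (\<gamma> {u, v})} = {p u, p v}"
    "E u v \<inter> p ` verts H = {p u, p v}"
    if "u \<in> W" "v \<in> W" "u \<noteq> v" for u v
    using D edge[OF that] unfolding plane_drawing_def E_def by auto
  have meet: "E u v \<inter> E u' v' \<subseteq> p ` ({u, v} \<inter> {u', v'})"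
    if "u \<in> W" "v \<in> W" "u \<noteq> v" "u' \<in> W" "v' \<in> W" "u' \<noteq> v'" "{u, v} \<noteq> {u', v'}" for u v u' v'
  proof -
    have "path_image (\<gamma> e) \<inter> path_image (\<gamma> f) \<subseteq> p ` (e \<inter> f)"
      if "e \<in> undirected_edges H" "f \<in> undirected_edges H" "e \<noteq> f" for e f
      using D that unfolding plane_drawing_def by metis
    from this[OF edge[OF that(1-3)] edge[OF that(4-6)] that(7)] show ?thesis unfolding E_def .
  qed
  obtain vs where vs: "set vs = W" "distinct vs"
    using assms(2) finite_distinct_list[of W] by (metis card.infinite zero_neq_numeral)
  then have "length vs = 5" using assms(2) distinct_card by metis
  then obtain a b c d e where "vs = [a, b, c, d, e]"
    by (auto simp: numeral_eq_Suc length_Suc_conv)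
  with vs have "distinct [a, b, c, d, e]" "W = {a, b, c, d, e}" by auto
  then show False
  proof (rule complete_graph_5_not_plane[where p = p and E = E])
    show "\<exists>g. arc g \<and> pathstart g = p x \<and> pathfinish g = p y \<and> path_image g = E x y"
      if "x \<in> W" "y \<in> W" "x \<noteq> y" for x y
    proof (cases "pathstart (\<gamma> {x, y}) = p x")
      case True
      then have "pathfinish (\<gamma> {x, y}) = p y" using e(2)[OF that] by (auto simp: doubleton_eq_iff)
      then show ?thesis using True e(1)[OF that] unfolding E_def by blast
    next
      case False
      \<comment> \<open>A drawing does not fix the direction of an edge; here the arc runs from
        \<open>y\<close> to \<open>x\<close> and is reversed.\<close>
      then have "pathstart (\<gamma> {x, y}) = p y" "pathfinish (\<gamma> {x, y}) = p x"
        using e(2)[OF that] by (auto simp: doubleton_eq_iff)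
      then show ?thesis using e(1)[OF that] unfolding E_def
        by (intro exI[of _ "reversepath (\<gamma> {x, y})"]) (simp add: arc_reversepath)
    qed
    show "E x y = E y x" for x y by (simp add: E_def insert_commute)
    show "p z \<notin> E x y" if "x \<in> W" "y \<in> W" "z \<in> W" "x \<noteq> y" "z \<noteq> x" "z \<noteq> y" for x y z
    proof
      assume "p z \<in> E x y"
      then have "p z \<in> {p x, p y}" using e(3)[of x y] that assms(1) by blast
      then show False using inj that by (auto simp: inj_on_def)
    qed
    show "E x y \<inter> E x z \<subseteq> {p x}"
      if "x \<in> W" "y \<in> W" "z \<in> W" "x \<noteq> y" "x \<noteq> z" "y \<noteq> z" for x y z
      using meet[of x y x z] that by (auto simp: doubleton_eq_iff)
    show "E x y \<inter> E z w = {}" if "distinct [x, y, z, w]" "{x, y, z, w} \<subseteq> W" for x y z w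
      using meet[of x y z w] that by (auto simp: doubleton_eq_iff)
  qed
qed

section \<open>Straight-line drawings\<close>

lemma planar_straight_line:
  fixes H :: "('v, 'e) pre_digraph" and p :: "'v \<Rightarrow> complex"
  assumes inj: "inj_on p (verts H)"
    and sub: "\<And>u v. (u, v) \<in> arcs_ends H \<Longrightarrow> u \<in> verts H \<and> v \<in> verts H \<and> u \<noteq> v"
    and vert: "\<And>u v w. (u, v) \<in> arcs_ends H \<Longrightarrow> w \<in> verts H \<Longrightarrow>
      p w \<in> closed_segment (p u) (p v) \<Longrightarrow> w \<in> {u, v}"
    and cross: "\<And>u v u' v' z. (u, v) \<in> arcs_ends H \<Longrightarrow> (u', v') \<in> arcs_ends H \<Longrightarrow> {u, v} \<noteq> {u', v'} \<Longrightarrow>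
      z \<in> closed_segment (p u) (p v) \<Longrightarrow> z \<in> closed_segment (p u') (p v') \<Longrightarrow> z \<in> p ` ({u, v} \<inter> {u', v'})"
  shows "planar H"
proof -
  \<comment> \<open>The segment is written as a convex hull so that the choice of arc depends on the
    unordered edge alone.\<close>
  have "\<exists>g. arc g \<and> {pathstart g, pathfinish g} = p ` e \<and> path_image g = convex hull (p ` e)"
    if e: "e \<in> undirected_edges H" for e
  proof -
    obtain u v where uv: "e = {u, v}" "(u, v) \<in> arcs_ends H"
      using e by (auto simp: undirected_edges_def)
    have "p u \<noteq> p v" using sub[OF uv(2)] inj by (auto simp: inj_on_def)
    then show ?thesis
      using uv(1) by (intro exI[of _ "linepath (p u) (p v)"]) (simp add: segment_convex_hull)
  qed
  then obtain \<gamma> where \<gamma>: "\<And>e. e \<in> undirected_edges H \<Longrightarrow> arc (\<gamma> e) \<and>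
      {pathstart (\<gamma> e), pathfinish (\<gamma> e)} = p ` e \<and> path_image (\<gamma> e) = convex hull (p ` e)"
    by metis
  have "plane_drawing H p \<gamma>"
    unfolding plane_drawing_def
  proof (intro conjI ballI impI)
    show "inj_on p (verts H)" by (rule inj)
  next
    fix e assume e: "e \<in> undirected_edges H"
    then obtain u v where uv: "e = {u, v}" "(u, v) \<in> arcs_ends H"
      by (auto simp: undirected_edges_def)
    have *: "path_image (\<gamma> e) = closed_segment (p u) (p v)"
      using \<gamma>[OF e] uv(1) by (simp add: segment_convex_hull)
    show "arc (\<gamma> e)" "{pathstart (\<gamma> e), pathfinish (\<gamma> e)} = p ` e" using \<gamma>[OF e] by auto
    show "path_image (\<gamma> e) \<inter> p ` verts H = p ` e"
      unfolding * using vert[OF uv(2)] sub[OF uv(2)] uv(1) by auto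
  next
    fix e f assume ef: "e \<in> undirected_edges H" "f \<in> undirected_edges H" "e \<noteq> f"
    then obtain u v u' v' where uv: "e = {u, v}" "(u, v) \<in> arcs_ends H"
      "f = {u', v'}" "(u', v') \<in> arcs_ends H"
      by (auto simp: undirected_edges_def)
    have "path_image (\<gamma> e) = closed_segment (p u) (p v)" "path_image (\<gamma> f) = closed_segment (p u') (p v')"
      using \<gamma> ef uv by (simp_all add: segment_convex_hull)
    then show "path_image (\<gamma> e) \<inter> path_image (\<gamma> f) \<subseteq> p ` (e \<inter> f)"
      using cross[OF uv(2,4)] ef(3) uv(1,3) by auto
  qed
  then show ?thesis unfolding planar_def by blast
qed

text \<open>Vertices 1 and 5 lie at -1 and 1 on the real axis, vertices 2, 3, 4 on the imaginary axis; the
  missing edges are those from 3 to 2 and to 4.\<close>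

definition kite_points :: "nat \<Rightarrow> complex" where
  "kite_points i = (if i = 1 then - 1 else if i = 2 then \<i> else if i = 3 then - \<i>
     else if i = 4 then 2 * \<i> else 1)"

definition kite_arcs :: "(nat \<times> nat) set" where
  "kite_arcs = {(1, 2), (1, 3), (1, 4), (1, 5), (5, 2), (5, 3), (5, 4), (2, 4)}"

text \<open>Each edge is listed once as an ordered pair, which gives its points one parametrisation
  and keeps the crossing check to one case per pair of listed arcs.\<close>

definition kite_edges :: "nat set set" where
  "kite_edges = (\<lambda>(i, j). {i, j}) ` kite_arcs"

lemma kite_edges_eq:
  "kite_edges = {{1, 2}, {1, 3}, {1, 4}, {1, 5}, {5, 2}, {5, 3}, {5, 4}, {2, 4}}"
  by (simp add: kite_edges_def kite_arcs_def)

lemma in_convex_hull_2_complexE: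
  fixes z :: complex
  assumes "z \<in> convex hull {a, b}"
  obtains u where "0 \<le> u" "u \<le> 1" "Re z = (1 - u) * Re a + u * Re b" "Im z = (1 - u) * Im a + u * Im b"
  using assms by (auto simp: closed_segment_def simp flip: segment_convex_hull)

text \<open>For each pair of edges, equating coordinates of the two parametrised points gives linear
  equations in \<open>u\<close> and \<open>v\<close>; they are contradictory or force a common
  end.\<close>

lemma kite_edges_cross:
  assumes "e \<in> kite_edges" "f \<in> kite_edges" "e \<noteq> f"
    and "z \<in> convex hull (kite_points ` e)" "z \<in> convex hull (kite_points ` f)"
  shows "z \<in> kite_points ` (e \<inter> f)"
proof -
  obtain i j where e: "e = {i, j}" and ij: "(i, j) \<in> kite_arcs"
    using assms(1) unfolding kite_edges_def by auto
  obtain k l where f: "f = {k, l}" and kl: "(k, l) \<in> kite_arcs"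
    using assms(2) unfolding kite_edges_def by auto
  obtain u where u: "0 \<le> u" "u \<le> 1"
    and z: "Re z = (1 - u) * Re (kite_points i) + u * Re (kite_points j)"
      "Im z = (1 - u) * Im (kite_points i) + u * Im (kite_points j)"
    using assms(4) unfolding e by (auto elim: in_convex_hull_2_complexE)
  obtain v where v: "0 \<le> v" "v \<le> 1"
    and z': "Re z = (1 - v) * Re (kite_points k) + v * Re (kite_points l)"
      "Im z = (1 - v) * Im (kite_points k) + v * Im (kite_points l)"
    using assms(5) unfolding f by (auto elim: in_convex_hull_2_complexE)
  show ?thesis
    using ij kl assms(3) u v z z' unfolding e f kite_arcs_def
    by (elim insertE emptyE) (simp_all add: kite_points_def doubleton_eq_iff complex_eq_iff)
qed

lemma doubleton_in_kite_edges:
  assumes "{i, j} \<subseteq> {1..5}" "i \<noteq> j" "{i, j} \<noteq> {2, 3}" "{i, j} \<noteq> {3, 4}"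
  shows "{i, j} \<in> kite_edges"
proof -
  have "i \<in> {1, 2, 3, 4, 5}" "j \<in> {1, 2, 3, 4, 5}" using assms(1) by auto
  then show ?thesis using assms(2-4) unfolding kite_edges_eq
    by (elim insertE emptyE) (simp_all add: doubleton_eq_iff)
qed

lemma inj_on_kite_points: "inj_on kite_points {1..5}"
proof -
  have "{1..5} = {1, 2, 3, 4, 5::nat}" by auto
  then show ?thesis by (simp add: kite_points_def complex_eq_iff)
qed

text \<open>Every vertex \<open>i\<close> lies on some edge \<open>f\<close>. If \<open>f\<close>
  differs from \<open>e\<close>, the point is a crossing of the two edges, hence the image of a
  common end, which is \<open>i\<close> by injectivity.\<close>

lemma kite_edges_vertex:
  assumes e: "e \<in> kite_edges" and i: "i \<in> {1..5}" and P: "kite_points i \<in> convex hull (kite_points ` e)"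
  shows "i \<in> e"
proof -
  have "i \<in> {1, 2, 3, 4, 5}" using i by auto
  then obtain f where f: "f \<in> kite_edges" "i \<in> f" unfolding kite_edges_eq by blast
  have sub: "f \<subseteq> {1..5}" using f(1) by (auto simp: kite_edges_eq)
  show ?thesis
  proof (cases "e = f")
    case False
    have "kite_points i \<in> convex hull (kite_points ` f)" using f(2) by (simp add: hull_inc)
    then have "kite_points i \<in> kite_points ` (e \<inter> f)"
      using kite_edges_cross[OF e f(1) False P] by blast
    then show ?thesis using inj_onD[OF inj_on_kite_points] i sub by blast
  qed (use f in simp)
qed

text \<open>The kite drawing is pulled back along the labelling \<open>f\<close>; injectivity keeps
  distinct edges distinct and preserves their intersections.\<close>

lemma planar_if_kite_embedding:
  fixes H :: "('v, 'e) pre_digraph"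
  assumes inj: "inj_on f (verts H)" and im: "f ` verts H \<subseteq> {1..5}"
    and sub: "\<And>u v. (u, v) \<in> arcs_ends H \<Longrightarrow> u \<in> verts H \<and> v \<in> verts H \<and> u \<noteq> v"
    and edge: "\<And>u v. (u, v) \<in> arcs_ends H \<Longrightarrow> {f u, f v} \<in> kite_edges"
  shows "planar H"
proof (rule planar_straight_line[where p = "kite_points \<circ> f"])
  show "inj_on (kite_points \<circ> f) (verts H)"
    using inj im inj_on_kite_points by (auto intro: comp_inj_on inj_on_subset)
  show "u \<in> verts H \<and> v \<in> verts H \<and> u \<noteq> v" if "(u, v) \<in> arcs_ends H" for u v
    using sub that by blast
  show "w \<in> {u, v}" if "(u, v) \<in> arcs_ends H" "w \<in> verts H"
    "(kite_points \<circ> f) w \<in> closed_segment ((kite_points \<circ> f) u) ((kite_points \<circ> f) v)" for u v w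
  proof -
    have "f w \<in> {f u, f v}"
      using kite_edges_vertex[OF edge[OF that(1)], of "f w"] that(2,3) im
      by (auto simp: segment_convex_hull)
    then show ?thesis using inj sub[OF that(1)] that(2) by (auto simp: inj_on_def)
  qed
  show "z \<in> (kite_points \<circ> f) ` ({u, v} \<inter> {u', v'})"
    if uv: "(u, v) \<in> arcs_ends H" "(u', v') \<in> arcs_ends H" "{u, v} \<noteq> {u', v'}"
      and "z \<in> closed_segment ((kite_points \<circ> f) u) ((kite_points \<circ> f) v)"
      "z \<in> closed_segment ((kite_points \<circ> f) u') ((kite_points \<circ> f) v')" for u v u' v' z
  proof -
    have V: "{u, v} \<subseteq> verts H" "{u', v'} \<subseteq> verts H" using sub uv by auto
    have "f ` {u, v} \<noteq> f ` {u', v'}"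
      using inj_on_image_eq_iff[OF inj V] uv(3) by simp
    then have "z \<in> kite_points ` (f ` {u, v} \<inter> f ` {u', v'})"
      using kite_edges_cross[of "f ` {u, v}" "f ` {u', v'}" z] edge[OF uv(1)] edge[OF uv(2)] that(4,5)
      by (simp add: segment_convex_hull)
    then show ?thesis
      by (metis image_comp inj_on_image_Int[OF inj V])
  qed
qed

section \<open>Proper power graphs of cyclic groups\<close>

text \<open>A common divisor divides the difference of \<open>n\<close> and \<open>2 * i\<close>,
  which is 2 or 4, but it is odd because it divides \<open>i\<close>.\<close>

lemma coprime_half_plus_minus:
  fixes n i :: nat
  assumes "odd i" "2 * i \<in> {n + 2, n + 4} \<or> n \<in> {2 * i + 2, 2 * i + 4}"
  shows "coprime n i"
proof (rule coprimeI)
  fix d assume d: "d dvd n" "d dvd i"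
  then have "d dvd 2 * i" by simp
  \<comment> \<open>Subtraction truncates at 0, so both orders are kept; one of them is the true
    difference.\<close>
  with d(1) have "d dvd 2 * i - n" "d dvd n - 2 * i" by (simp_all add: dvd_diff_nat)
  moreover have "2 * i - n \<in> {2, 4} \<or> n - 2 * i \<in> {2, 4}" using assms(2) by auto
  ultimately have "d dvd 2 \<or> d dvd 4" by auto
  then have "d dvd 4" using dvd_trans[of d 2 4] by auto
  moreover have "coprime d 4"
  proof -
    have "coprime d 2" using d(2) assms(1) by (metis coprime_right_2_iff_odd dvd_trans)
    then have "coprime d (2 * 2)" unfolding coprime_mult_right_iff by blast
    then show ?thesis by simp
  qed
  ultimately show "is_unit d" by (metis coprime_common_divisor dvd_refl)
qed

text \<open>Besides 1 and \<open>n - 1\<close>, odd \<open>n\<close> offers 2 and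
  \<open>n - 2\<close>, and even \<open>n\<close> offers two odd numbers symmetric about
  \<open>n / 2\<close>. The extra residue \<open>k\<close> may share factors with
  \<open>n\<close>.\<close>

lemma four_coprime_residues:
  fixes n :: nat
  assumes "n \<ge> 7"
  obtains A k where "A \<subseteq> {1..<n}" "card A = 4" "\<And>i. i \<in> A \<Longrightarrow> coprime n i" "k \<in> {1..<n}" "k \<notin> A"
proof -
  have n1: "coprime n (n - 1)"
    using assms by (metis coprime_commute coprime_diff_one_left_nat not_numeral_le_zero gr0I)
  show ?thesis
  proof (cases "even n")
    case False
    have "coprime n (n - 2)"
    proof (rule coprimeI)
      fix d assume "d dvd n" "d dvd n - 2"
      then have "d dvd 2" using assms dvd_diffD1[of d n 2] by auto
      then show "is_unit d" using False \<open>d dvd n\<close> by (metis coprime_common_divisor coprime_right_2_iff_odd)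
    qed
    then have "coprime n i" if "i \<in> {1, 2, n - 2, n - 1}" for i
      using that n1 False by auto
    moreover have "card {1, 2, n - 2, n - 1} = 4" "{1, 2, n - 2, n - 1} \<subseteq> {1..<n}"
      "3 \<notin> {1, 2, n - 2, n - 1}" "3 \<in> {1..<n}"
      using assms by (auto simp: card_insert_if)
    ultimately show ?thesis using that by blast
  next
    case True
    then obtain m where m: "n = 2 * m" by blast
    \<comment> \<open>The offset has parity opposite to \<open>m\<close>, so \<open>m - j\<close>
      and \<open>m + j\<close> are odd; \<open>n \<ge> 7\<close> leaves
      \<open>m - j \<ge> 3\<close>, clear of 1 and 2.\<close>
    define j :: nat where "j = (if even m then 1 else 2)"
    have j: "odd (m + j)" "odd (m - j)" "m \<ge> j + 3" "j \<in> {1, 2}"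
      using assms m by (auto simp: j_def) presburger+
    have "coprime n (m + j)" "coprime n (m - j)"
      using j m by (intro coprime_half_plus_minus; force)+
    then have "coprime n i" if "i \<in> {1, m - j, m + j, n - 1}" for i
      using that n1 by auto
    moreover have "card {1, m - j, m + j, n - 1} = 4" "{1, m - j, m + j, n - 1} \<subseteq> {1..<n}"
      "2 \<notin> {1, m - j, m + j, n - 1}" "2 \<in> {1..<n}"
      using j m by (auto simp: card_insert_if)
    ultimately show ?thesis using that by blast
  qed
qed

section \<open>Adjacency in the proper power graph and powers in cyclic groups\<close>

lemma verts_proper_power_graph:
  "verts (proper_power_graph G) = carrier G - {\<one>\<^bsub>G\<^esub>}"
  by (simp add: proper_power_graph_def power_graph_def pre_digraph.del_vert_simps)

lemma arcs_ends_proper_power_graph: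
  "(a, b) \<in> arcs_ends (proper_power_graph G) \<longleftrightarrow>
     a \<in> carrier G - {\<one>\<^bsub>G\<^esub>} \<and> b \<in> carrier G - {\<one>\<^bsub>G\<^esub>} \<and> a \<noteq> b \<and>
     (a \<in> generate G {b} \<or> b \<in> generate G {a})"
  by (auto simp: proper_power_graph_def power_graph_def pre_digraph.del_vert_simps arcs_ends_conv)

context group begin

lemma cyclic_generator:
  assumes "cyclic_group G" "finite (carrier G)"
  obtains g where "g \<in> carrier G" "ord g = Coset.order G" "bij_betw (\<lambda>k. g [^] k) {0..<Coset.order G} (carrier G)"
proof -
  obtain g where g: "g \<in> carrier G" "carrier G = range (\<lambda>n::int. g [^] n)"
    using assms(1) by (auto simp: cyclic_group)
  have gen: "generate G {g} = carrier G"
    using generate_pow[OF g(1)] g(2) by auto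
  then have o: "ord g = Coset.order G" using generate_pow_card[OF g(1)] by (simp add: Coset.order_def)
  have pos: "Coset.order G > 0" using assms(2) by (simp add: order_gt_0_iff_finite)
  \<comment> \<open>Injectivity is known for exponents up to \<open>ord g - 1\<close>; positivity of
    the order makes this the half-open range.\<close>
  have inj: "inj_on (\<lambda>k. g [^] k) {0..<Coset.order G}"
    using ord_inj[OF g(1)] o pos by (simp add: atLeastLessThanSuc_atLeastAtMost[symmetric])
  have "(\<lambda>k. g [^] k) ` {0..<Coset.order G} = carrier G"
    using g(1) assms(2) card_image[OF inj] by (intro card_subset_eq) (auto simp: Coset.order_def)
  then show ?thesis using that g(1) o inj by (simp add: bij_betw_def)
qed

text \<open>A coprime exponent preserves the order of \<open>g\<close>, so the generated subgroup
  already has the cardinality of the finite group.\<close>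

lemma generate_coprime_pow:
  assumes "g \<in> carrier G" "ord g = Coset.order G" "finite (carrier G)" "coprime (Coset.order G) k"
  shows "generate G {g [^] (k::nat)} = carrier G"
proof -
  have "ord (g [^] k) = Coset.order G"
    using ord_pow_gen[OF assms(1), of k] assms(2,4) by auto
  then have "card (generate G {g [^] k}) = card (carrier G)"
    using generate_pow_card[of "g [^] k"] assms(1) by (simp add: Coset.order_def)
  then show ?thesis
    using assms(1,3) generate_incl[of "{g [^] k}"] by (intro card_subset_eq) auto
qed

text \<open>\<open>y\<close> is a power of \<open>x\<close>, and exponents commute. This rules out
  adjacency between an element of order 2 and one of order 3.\<close>

lemma generate_annihilated:
  assumes "x \<in> carrier G" "y \<in> generate G {x}" "x [^] (k::nat) = \<one>"
  shows "y [^] k = \<one>"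
proof -
  obtain i :: int where y: "y = x [^] i" using generate_pow[OF assms(1)] assms(2) by auto
  have "y [^] k = x [^] (i * int k)"
    using assms(1) y by (simp add: int_pow_pow flip: int_pow_int)
  also have "\<dots> = (x [^] int k) [^] i" using assms(1) by (simp add: int_pow_pow mult.commute)
  finally show ?thesis using assms(3) by (simp add: int_pow_int)
qed

end

section \<open>Planarity according to the order of the group\<close>

lemma (in group) proper_power_graph_not_planar:
  assumes "cyclic_group G" "finite (carrier G)" "Coset.order G \<ge> 7"
  shows "\<not> planar (proper_power_graph G)"
proof -
  obtain g where g: "g \<in> carrier G" "ord g = Coset.order G"
    and bij: "bij_betw (\<lambda>k::nat. g [^] k) {0..<Coset.order G} (carrier G)"
    using cyclic_generator[OF assms(1,2)] by blast
  obtain A k where A: "A \<subseteq> {1..<Coset.order G}" "card A = 4" "\<And>i. i \<in> A \<Longrightarrow> coprime (Coset.order G) i"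
    and k: "k \<in> {1..<Coset.order G}" "k \<notin> A"
    using four_coprime_residues[OF assms(3)] by blast
  have inj: "inj_on (\<lambda>k::nat. g [^] k) {0..<Coset.order G}" using bij by (rule bij_betw_imp_inj_on)
  have sub: "insert k A \<subseteq> {0..<Coset.order G}" using A k by auto
  show ?thesis
  proof (rule not_planar_if_complete_5[where W = "(\<lambda>k. g [^] k) ` insert k A"])
    have "g [^] i \<noteq> \<one>" if "i \<in> insert k A" for i
      using inj_onD[OF inj, of i 0] that A(1) k(1) by auto
    then show V: "(\<lambda>k. g [^] k) ` insert k A \<subseteq> verts (proper_power_graph G)"
      using g(1) by (auto simp: verts_proper_power_graph)
    have "finite A" using A(1) finite_subset by blast
    then show "card ((\<lambda>k. g [^] k) ` insert k A) = 5"
      using card_image[OF inj_on_subset[OF inj sub]] A(2) k(2) by simp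
    fix u v assume uv: "u \<in> (\<lambda>k. g [^] k) ` insert k A" "v \<in> (\<lambda>k. g [^] k) ` insert k A" "u \<noteq> v"
    have "generate G {g [^] i} = carrier G" if "i \<in> A" for i
      using generate_coprime_pow[OF g assms(2)] A(3) that by blast
    \<comment> \<open>Only the vertex with exponent \<open>k\<close> may fail to generate the group,
      so of two distinct vertices at least one is a generator.\<close>
    then have "generate G {u} = carrier G \<or> generate G {v} = carrier G" using uv by auto
    then show "(u, v) \<in> arcs_ends (proper_power_graph G)"
      using uv V by (auto simp: arcs_ends_proper_power_graph verts_proper_power_graph)
  qed
qed

lemma (in group) proper_power_graph_planar:
  assumes "cyclic_group G" "finite (carrier G)" "Coset.order G \<le> 6"
  shows "planar (proper_power_graph G)"
proof -
  obtain g where g: "g \<in> carrier G" "ord g = Coset.order G"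
    and bij: "bij_betw (\<lambda>k::nat. g [^] k) {0..<Coset.order G} (carrier G)"
    using cyclic_generator[OF assms(1,2)] by blast
  let ?V = "verts (proper_power_graph G)"
  have V: "?V = carrier G - {\<one>}" by (rule verts_proper_power_graph)
  have arcs: "u \<in> ?V \<and> v \<in> ?V \<and> u \<noteq> v" if "(u, v) \<in> arcs_ends (proper_power_graph G)" for u v
    using that unfolding V arcs_ends_proper_power_graph by blast
  show ?thesis
  proof (cases "Coset.order G = 6")
    case False
    \<comment> \<open>At most four vertices remain, and the labels 1, 2, 4, 5 are pairwise joined in
      the kite, so any injective labelling works.\<close>
    have "card ?V = Coset.order G - 1" using assms(2) by (simp add: V Coset.order_def)
    then have "card ?V \<le> card {1, 2, 4, 5::nat}" using False assms(3) by simp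
    then obtain f where f: "f ` ?V \<subseteq> {1, 2, 4, 5::nat}" "inj_on f ?V"
      using card_le_inj[of ?V "{1, 2, 4, 5::nat}"] assms(2) V by auto
    show ?thesis
    proof (rule planar_if_kite_embedding[OF f(2)])
      show "{f u, f v} \<in> kite_edges" if "(u, v) \<in> arcs_ends (proper_power_graph G)" for u v
      proof -
        have "{f u, f v} \<subseteq> {1, 2, 4, 5}" "f u \<noteq> f v"
          using arcs[OF that] f by (auto simp: inj_on_def)
        then show ?thesis by (intro doubleton_in_kite_edges) (auto simp: doubleton_eq_iff)
      qed
    qed (use f arcs in auto)
  next
    case True
    \<comment> \<open>Each element is labelled by its exponent with respect to \<open>g\<close>. The
      labels 1 and 5 belong to generators, 3 to the involution, 2 and 4 to the elements of order
      3.\<close>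
    define f where "f = the_inv_into {0..<6} (\<lambda>k::nat. g [^] k)"
    have inj: "inj_on (\<lambda>k::nat. g [^] k) {0..<6}" and im: "(\<lambda>k::nat. g [^] k) ` {0..<6} = carrier G"
      using bij True by (auto simp: bij_betw_def)
    have fg: "g [^] f x = x" if "x \<in> carrier G" for x
      unfolding f_def using f_the_inv_into_f[OF inj] that im by auto
    have f6: "f x \<in> {0..<6}" if "x \<in> carrier G" for x
      unfolding f_def using the_inv_into_into[OF inj, of x "{0..<6}"] that im by auto
    have fV: "f x \<in> {1..5}" if "x \<in> ?V" for x
    proof -
      have "f x \<noteq> 0" using fg[of x] that by (auto simp: V intro: ccontr)
      then show ?thesis using f6[of x] that by (auto simp: V)
    qed
    have injf: "inj_on f ?V" using fg by (intro inj_on_inverseI[where g = "\<lambda>k. g [^] k"]) (auto simp: V)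
    have pow1: "(g [^] i) [^] k = \<one> \<longleftrightarrow> 6 dvd i * k" for i k :: nat
      using pow_eq_id[OF g(1), of "i * k"] g True by (simp add: nat_pow_pow)
    \<comment> \<open>Orders 2 and 3 exclude membership either way, so the pairs absent from the
      kite are not adjacent.\<close>
    have no3: False if "x \<in> ?V" "y \<in> ?V" "f x = 3" "f y \<in> {2, 4}"
      "x \<in> generate G {y} \<or> y \<in> generate G {x}" for x y
    proof -
      have xy: "x \<in> carrier G" "y \<in> carrier G" using that(1,2) V by auto
      have xg: "x = g [^] (3::nat)" and yg: "y = g [^] f y"
        using fg[OF xy(1)] fg[OF xy(2)] that(3) by simp_all
      have x: "x [^] (2::nat) = \<one>" "x [^] (3::nat) \<noteq> \<one>" using pow1[of 3 2] pow1[of 3 3] xg by auto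
      have y: "y [^] (3::nat) = \<one>" "y [^] (2::nat) \<noteq> \<one>"
        using pow1[of "f y" 3] pow1[of "f y" 2] that(4) unfolding yg[symmetric] by auto
      show False
        using that(5) generate_annihilated[OF xy(1), of y 2] generate_annihilated[OF xy(2), of x 3] x y
        by auto
    qed
    show ?thesis
    proof (rule planar_if_kite_embedding[OF injf])
      show "{f u, f v} \<in> kite_edges" if uv: "(u, v) \<in> arcs_ends (proper_power_graph G)" for u v
      proof -
        have "u \<in> generate G {v} \<or> v \<in> generate G {u}"
          using uv by (simp add: arcs_ends_proper_power_graph)
        moreover have uv': "u \<in> ?V" "v \<in> ?V" "f u \<noteq> f v"
          using arcs[OF uv] injf by (auto simp: inj_on_def)
        ultimately show ?thesis using no3[of u v] no3[of v u] fV[OF uv'(1)] fV[OF uv'(2)]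
          by (intro doubleton_in_kite_edges) (auto simp: doubleton_eq_iff)
      qed
    qed (use fV arcs in auto)
  qed
qed

theorem theorem4p2:
  fixes G :: "('g, 'm) monoid_scheme" and n :: nat
  assumes "group G"
    and "finite (carrier G)"
    and "cyclic_group G"
    and "Coset.order G = n"
  shows "\<not> planar (proper_power_graph G) \<longleftrightarrow> n \<ge> 7"
  using group.proper_power_graph_not_planar[OF assms(1,3,2)]
    group.proper_power_graph_planar[OF assms(1,3,2)] assms(4)
  by (cases "n \<ge> 7") auto

end
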